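(* Let $(\mathcal{X},\mathcal{F},\mathcal{P})$ be a statistical model, let $\mathcal{M}$ be a finite index set, and for each $\mathbf{P}\in\mathcal{P}$ let $\mathcal{M}_0(\mathbf{P}),\mathcal{M}_1(\mathbf{P})$ be disjoint subsets of $\mathcal{M}$ with union $\mathcal{M}$. Let $\mathbf{\Delta}=(\Delta_m: m\in\mathcal{M})$, $\Delta_m=\{\delta_m(\alpha):\alpha\in[0,1]\}$, be an $\mathcal{M}$-indexed multiple decision process satisfying conditions (D1)--(D4) listed in the context, and let $\mathbf{A}=(A_m: m\in\mathcal{M})$ be an $\mathcal{M}$-indexed collection of measurable functions $A_m:[0,1]\to[0,1]$ satisfying conditions (A1)--(A3) listed in the context. Assume that the generalized $P$-value statistics $\alpha_m=\inf\{\alpha\in[0,1]:\delta_m(A_m(\alpha))=1\}$, $m\in\mathcal{M}$, are almost surely pairwise distinct under every $\mathbf{P}\in\mathcal{P}$. For $q\in[0,1]$ define the random variable $$\alpha^\dagger(q)=\inf\Big\{\alpha\in[0,1]:\ \prod_{m\in\mathcal{M}}[1-A_m(\alpha)]^{1-\delta_m(A_m(\alpha)-)}<1-q\Big\},$$ and for $\mathbf{P}\in\mathcal{P}$ and $\alpha\in[0,1]$ let $S_0(\alpha;\mathbf{P})=\sum_{m\in\mathcal{M}_0(\mathbf{P})}\delta_m(A_m(\alpha))$. Then for every $\mathbf{P}\in\mathcal{P}$ and every $q\in[0,1]$, $$E_{\mathbf{P}}\big\{I\{S_0(\alpha^\dagger(q);\mathbf{P})\ge 1\}\big\}\le q,$$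 that is, the multiple decision function $\big(\delta_m[A_m(\alpha^\dagger(q))]: m\in\mathcal{M}\big)$ has family-wise error rate at most $q$ under every $\mathbf{P}\in\mathcal{P}$.
   Context: $(\mathcal{X},\mathcal{F})$ is a measurable space and $\mathcal{P}$ is a collection of probability measures on it; $E_{\mathbf{P}}$ denotes expectation under $\mathbf{P}$, $I\{\cdot\}$ is the indicator function, and "a.e.-$\mathcal{P}$" means almost surely under every $\mathbf{P}\in\mathcal{P}$. A (nonrandomized) decision function is a measurable map $\delta:\mathcal{X}\to\{0,1\}$. For each $m\in\mathcal{M}$ and $\alpha\in[0,1]$, $\delta_m(\alpha)$ is a decision function, i.e. a $\{0,1\}$-valued random variable $x\mapsto\delta_m(x;\alpha)$ on $\mathcal{X}$; $\Delta_m=\{\delta_m(\alpha):\alpha\in[0,1]\}$ is viewed as a stochastic process in $\alpha$. In the multiple testing interpretation, the $m$th null hypothesis is true under $\mathbf{P}$ if and only if $m\in\mathcal{M}_0(\mathbf{P})$, and $\delta_m=1$ means that the $m$th null hypothesis is rejected. Conditions on $\mathbf{\Delta}$: (D1) For each $m\in\mathcal{M}$, $\delta_m(0)=0$ and $\delta_m(1)=1$ a.e.-$\mathcal{P}$. (D2) For each $m\in\mathcal{M}$, the sample paths $\alpha\mapsto\delta_m(\alpha)$ are, a.e.-$\mathcal{P}$, $\{0,1\}$-valued step functions which are nondecreasing and right-continuous. (D3) For each $\mathbf{P}\in\mathcal{P}$, under $\mathbf{P}$ the subcollections $\{\Delta_m: m\in\mathcal{M}_0(\mathbf{P})\}$ and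 $\{\Delta_m: m\in\mathcal{M}_1(\mathbf{P})\}$ are independent of each other, and the elements of $\{\Delta_m: m\in\mathcal{M}_0(\mathbf{P})\}$ are independent. (The elements of $\{\Delta_m: m\in\mathcal{M}_1(\mathbf{P})\}$ need not be independent of each other.) (D4) For all $\mathbf{P}\in\mathcal{P}$, all $m\in\mathcal{M}_0(\mathbf{P})$ and all $\alpha\in[0,1]$, $E_{\mathbf{P}}\{\delta_m(\alpha)\}=\alpha$. Conditions on $\mathbf{A}$, for each $m\in\mathcal{M}$: (A1) $A_m(0)=0$ and $A_m(1)=1$. (A2) The mapping $\alpha\mapsto A_m(\alpha)$ is continuous and strictly increasing on $[0,1]$. (A3) For all $\alpha\in[0,1]$, $\prod_{m\in\mathcal{M}}[1-A_m(\alpha)]\ge 1-\alpha$. Notation: $\delta_m(A_m(\alpha)-)$ denotes the left limit of $t\mapsto\delta_m(t)$ at $t=A_m(\alpha)$ (at $\alpha=0$ its value is immaterial because $1-A_m(0)=1$). Conventions: $0^0=1$, and the infimum is taken within $[0,1]$, so $\inf\emptyset=1$. *)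

theory Defs
  imports "HOL-Probability.Probability"
begin

text \<open>
  Decision processes are curried functions \<open>\<delta> m \<alpha> x\<close> with values in \<open>nat\<close>, restricted to
  \<open>{0, 1}\<close> by measurability into \<open>count_space {0, 1}\<close>. With \<open>nat\<close> exponents the power \<open>0 ^ 0\<close>
  is \<open>1\<close>, as required. Only levels \<open>\<alpha>\<close> in \<open>{0..1}\<close> are constrained.
\<close>

definition statistical_model :: "'x measure \<Rightarrow> 'x measure set \<Rightarrow> bool" where
  "statistical_model F \<P> \<longleftrightarrow> (\<forall>P\<in>\<P>. prob_space P \<and> sets P = sets F)"

definition AE_all :: "'x measure set \<Rightarrow> ('x \<Rightarrow> bool) \<Rightarrow> bool" where
  "AE_all \<P> Q \<longleftrightarrow> (\<forall>P\<in>\<P>. AE x in P. Q x)"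

definition decision_process ::
  "'x measure \<Rightarrow> 'm set \<Rightarrow> ('m \<Rightarrow> real \<Rightarrow> 'x \<Rightarrow> nat) \<Rightarrow> bool" where
  "decision_process F M \<delta> \<longleftrightarrow>
     (\<forall>m\<in>M. \<forall>\<alpha>\<in>{0..1}. \<delta> m \<alpha> \<in> measurable F (count_space {0, 1}))"

definition step_function_on :: "real set \<Rightarrow> (real \<Rightarrow> nat) \<Rightarrow> bool" where
  "step_function_on S f \<longleftrightarrow>
     (\<exists>\<J>. finite \<J> \<and> \<Union>\<J> = S \<and> (\<forall>J\<in>\<J>. is_interval J \<and> f constant_on J))"

definition cond_D1 ::
  "'x measure set \<Rightarrow> 'm set \<Rightarrow> ('m \<Rightarrow> real \<Rightarrow> 'x \<Rightarrow> nat) \<Rightarrow> bool" where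
  "cond_D1 \<P> M \<delta> \<longleftrightarrow> (\<forall>m\<in>M. AE_all \<P> (\<lambda>x. \<delta> m 0 x = 0 \<and> \<delta> m 1 x = 1))"

definition cond_D2 ::
  "'x measure set \<Rightarrow> 'm set \<Rightarrow> ('m \<Rightarrow> real \<Rightarrow> 'x \<Rightarrow> nat) \<Rightarrow> bool" where
  "cond_D2 \<P> M \<delta> \<longleftrightarrow> (\<forall>m\<in>M. AE_all \<P> (\<lambda>x.
     (\<forall>\<alpha>\<in>{0..1}. \<delta> m \<alpha> x \<in> {0, 1}) \<and>
     step_function_on {0..1} (\<lambda>\<alpha>. \<delta> m \<alpha> x) \<and>
     mono_on {0..1} (\<lambda>\<alpha>. \<delta> m \<alpha> x) \<and>
     (\<forall>\<alpha>\<in>{0..<1}. continuous (at_right \<alpha>) (\<lambda>\<alpha>. \<delta> m \<alpha> x))))"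

text \<open>
  The process \<open>\<Delta>\<^sub>m\<close> as a single random element, namely the path \<open>\<alpha> \<mapsto> \<delta>\<^sub>m(\<alpha>)\<close> in the
  product space \<open>{0, 1}\<close> to the power \<open>[0, 1]\<close> with its product sigma-algebra.
\<close>

abbreviation path_space :: "(real \<Rightarrow> nat) measure" where
  "path_space \<equiv> PiM {0..1} (\<lambda>_. count_space {0, 1})"

definition sample_path :: "('m \<Rightarrow> real \<Rightarrow> 'x \<Rightarrow> nat) \<Rightarrow> 'm \<Rightarrow> 'x \<Rightarrow> real \<Rightarrow> nat" where
  "sample_path \<delta> m x = (\<lambda>\<alpha>\<in>{0..1}. \<delta> m \<alpha> x)"

definition cond_D3 ::
  "'x measure set \<Rightarrow> ('x measure \<Rightarrow> 'm set) \<Rightarrow> ('x measure \<Rightarrow> 'm set) \<Rightarrow>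
     ('m \<Rightarrow> real \<Rightarrow> 'x \<Rightarrow> nat) \<Rightarrow> bool" where
  "cond_D3 \<P> M0 M1 \<delta> \<longleftrightarrow> (\<forall>P\<in>\<P>.
     prob_space.indep_var P
       (PiM (M0 P) (\<lambda>_. path_space)) (\<lambda>x. \<lambda>m\<in>M0 P. sample_path \<delta> m x)
       (PiM (M1 P) (\<lambda>_. path_space)) (\<lambda>x. \<lambda>m\<in>M1 P. sample_path \<delta> m x) \<and>
     prob_space.indep_vars P (\<lambda>_. path_space) (\<lambda>m x. sample_path \<delta> m x) (M0 P))"

definition cond_D4 ::
  "'x measure set \<Rightarrow> ('x measure \<Rightarrow> 'm set) \<Rightarrow> ('m \<Rightarrow> real \<Rightarrow> 'x \<Rightarrow> nat) \<Rightarrow> bool" where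
  "cond_D4 \<P> M0 \<delta> \<longleftrightarrow>
     (\<forall>P\<in>\<P>. \<forall>m\<in>M0 P. \<forall>\<alpha>\<in>{0..1}. (LINT x|P. real (\<delta> m \<alpha> x)) = \<alpha>)"

definition measurable_unit_maps :: "'m set \<Rightarrow> ('m \<Rightarrow> real \<Rightarrow> real) \<Rightarrow> bool" where
  "measurable_unit_maps M A \<longleftrightarrow>
     (\<forall>m\<in>M. A m \<in> measurable (restrict_space borel {0..1}) (restrict_space borel {0..1}))"

definition cond_A1 :: "'m set \<Rightarrow> ('m \<Rightarrow> real \<Rightarrow> real) \<Rightarrow> bool" where
  "cond_A1 M A \<longleftrightarrow> (\<forall>m\<in>M. A m 0 = 0 \<and> A m 1 = 1)"

definition cond_A2 :: "'m set \<Rightarrow> ('m \<Rightarrow> real \<Rightarrow> real) \<Rightarrow> bool" where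
  "cond_A2 M A \<longleftrightarrow> (\<forall>m\<in>M. continuous_on {0..1} (A m) \<and> strict_mono_on {0..1} (A m))"

definition cond_A3 :: "'m set \<Rightarrow> ('m \<Rightarrow> real \<Rightarrow> real) \<Rightarrow> bool" where
  "cond_A3 M A \<longleftrightarrow> (\<forall>\<alpha>\<in>{0..1}. (\<Prod>m\<in>M. 1 - A m \<alpha>) \<ge> 1 - \<alpha>)"

text \<open>Infimum within \<open>[0, 1]\<close>, so that the infimum of the empty set is \<open>1\<close>.\<close>

definition unit_Inf :: "real set \<Rightarrow> real" where
  "unit_Inf S = (if S = {} then 1 else Inf S)"

definition left_lim :: "(real \<Rightarrow> nat) \<Rightarrow> real \<Rightarrow> nat" where
  "left_lim f t = Lim (at_left t) f"

definition gen_p_value ::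
  "('m \<Rightarrow> real \<Rightarrow> 'x \<Rightarrow> nat) \<Rightarrow> ('m \<Rightarrow> real \<Rightarrow> real) \<Rightarrow> 'm \<Rightarrow> 'x \<Rightarrow> real" where
  "gen_p_value \<delta> A m x = unit_Inf {\<alpha>\<in>{0..1}. \<delta> m (A m \<alpha>) x = 1}"

definition alpha_dagger ::
  "'m set \<Rightarrow> ('m \<Rightarrow> real \<Rightarrow> 'x \<Rightarrow> nat) \<Rightarrow> ('m \<Rightarrow> real \<Rightarrow> real) \<Rightarrow> real \<Rightarrow> 'x \<Rightarrow> real" where
  "alpha_dagger M \<delta> A q x = unit_Inf {\<alpha>\<in>{0..1}.
     (\<Prod>m\<in>M. (1 - A m \<alpha>) ^ (1 - left_lim (\<lambda>t. \<delta> m t x) (A m \<alpha>))) < 1 - q}"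

definition S0 ::
  "('x measure \<Rightarrow> 'm set) \<Rightarrow> ('m \<Rightarrow> real \<Rightarrow> 'x \<Rightarrow> nat) \<Rightarrow> ('m \<Rightarrow> real \<Rightarrow> real) \<Rightarrow>
     'x measure \<Rightarrow> real \<Rightarrow> 'x \<Rightarrow> nat" where
  "S0 M0 \<delta> A P \<alpha> x = (\<Sum>m\<in>M0 P. \<delta> m (A m \<alpha>) x)"

text \<open>
  The regularity of the paths holds only almost surely, and the exceptional null sets are
  arbitrary, so an event depending on the whole path need only be measurable up to a null set.
  Its expectation is therefore taken under the completion of \<open>P\<close>, which agrees with \<open>P\<close> on
  \<open>sets P\<close>.
\<close>

definition family_wise_error_rate :: "'x measure \<Rightarrow> 'm set \<Rightarrow> ('m \<Rightarrow> 'x \<Rightarrow> nat) \<Rightarrow> real" where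
  "family_wise_error_rate P H0 d =
     (LINT x|completion P. indicat_real {x. (\<Sum>m\<in>H0. d m x) \<ge> 1} x)"

end

theory Submission
  imports Defs
begin

text \<open>
  Let \<open>w\<^sub>0\<close> solve \<open>\<Prod>m\<in>M\<^sub>0. (1 - A\<^sub>m w\<^sub>0) = 1 - q\<close>. If no true null hypothesis is rejected at level
  \<open>w\<^sub>0\<close>, then by right-continuity none is rejected just above \<open>w\<^sub>0\<close>, so there the product defining
  \<open>\<alpha>\<^sup>\<dagger>(q)\<close> retains all the null factors and is below \<open>1 - q\<close>; hence \<open>\<alpha>\<^sup>\<dagger>(q)\<close> comes before the
  first null rejection. By independence, some true null is rejected at level \<open>w\<^sub>0\<close> with
  probability \<open>1 - \<Prod>m\<in>M\<^sub>0. (1 - A\<^sub>m w\<^sub>0) = q\<close>.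
\<close>

section \<open>Deterministic properties of a single sample path\<close>

definition decision_path :: "(real \<Rightarrow> nat) \<Rightarrow> bool" where
  "decision_path f \<longleftrightarrow> f 0 = 0 \<and> f 1 = 1 \<and> (\<forall>t\<in>{0..1}. f t \<in> {0, 1}) \<and> mono_on {0..1} f \<and>
     (\<forall>t\<in>{0..<1}. continuous (at_right t) f)"

text \<open>Since \<open>nat\<close> is discrete, right-continuity at \<open>t\<close> means that
  the path is constant on some interval just to the right of \<open>t\<close>; this is the form in
  which it is used.\<close>

lemma decision_pathD:
  assumes "decision_path f"
  shows "f 0 = 0" "f 1 = 1" "\<And>t. t \<in> {0..1} \<Longrightarrow> f t = 0 \<or> f t = 1"
    "\<And>s t. 0 \<le> s \<Longrightarrow> s \<le> t \<Longrightarrow> t \<le> 1 \<Longrightarrow> f s \<le> f t"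
    "\<And>t. 0 \<le> t \<Longrightarrow> t < 1 \<Longrightarrow> \<forall>\<^sub>F u in at_right t. f u = f t"
  using assms
  by (auto simp: decision_path_def mono_on_def continuous_within tendsto_discrete)

text \<open>\<open>left_lim\<close> is a definite description and says nothing until the limit is
  known to exist. Monotonicity provides it: if the value 1 occurs before \<open>t\<close>, the path
  stays at 1 up to \<open>t\<close>; otherwise it is 0 all the way.\<close>

lemma eventually_at_left_eq_left_lim:
  assumes f: "decision_path f" and t: "0 < t" "t \<le> 1"
  shows "\<forall>\<^sub>F u in at_left t. f u = left_lim f t"
proof -
  note D = decision_pathD[OF f]
  have "\<exists>c. \<forall>\<^sub>F u in at_left t. f u = c"
  proof (cases "\<exists>s. 0 \<le> s \<and> s < t \<and> f s = 1")
    case True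
    then obtain s where s: "0 \<le> s" "s < t" "f s = 1" by blast
    have "\<forall>\<^sub>F u in at_left t. f u = 1"
      using eventually_at_left_real[OF s(2)]
    proof eventually_elim
      case (elim u)
      then show ?case using D(3)[of u] D(4)[of s u] s t by auto
    qed
    then show ?thesis by blast
  next
    case False
    have "\<forall>\<^sub>F u in at_left t. f u = 0"
      using eventually_at_left_real[OF t(1)]
    proof eventually_elim
      case (elim u)
      then show ?case using D(3)[of u] False t by auto
    qed
    then show ?thesis by blast
  qed
  then obtain c where c: "\<forall>\<^sub>F u in at_left t. f u = c" by blast
  then have "(f \<longlongrightarrow> c) (at_left t)" by (simp add: tendsto_discrete)
  then have "left_lim f t = c"
    unfolding left_lim_def by (intro tendsto_Lim) (auto simp: trivial_limit_at_left_real)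
  with c show ?thesis by simp
qed

lemma left_lim_le:
  assumes f: "decision_path f" and t: "0 < t" "t \<le> 1"
  shows "left_lim f t \<le> f t"
proof -
  have "\<forall>\<^sub>F u in at_left t. f u = left_lim f t \<and> u \<in> {0<..<t}"
    using eventually_at_left_eq_left_lim[OF assms] eventually_at_left_real[OF t(1)]
    by (rule eventually_conj)
  then obtain u where "f u = left_lim f t" "u \<in> {0<..<t}"
    using eventually_happens'[OF trivial_limit_at_left_real] by blast
  then show ?thesis using decision_pathD(4)[OF f, of u t] t by auto
qed

text \<open>Used to replace an event \<open>E\<close> that depends on whole paths, and so may fail
  to be measurable, by a measurable \<open>E'\<close> that differs from it only on a null set.
  Integrability is recorded separately because the integral of a non-integrable function is 0 by
  default, which would make an upper bound on it empty.\<close>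

lemma integral_completion_indicator_AE_eq:
  assumes P: "finite_measure P" and E': "E' \<in> sets P" and AE: "AE x in P. x \<in> E \<longleftrightarrow> x \<in> E'"
  shows "integrable (completion P) (indicat_real E)"
    and "(LINT x|completion P. indicat_real E x) = measure P E'"
proof -
  interpret P: finite_measure P by fact
  have AEC: "AE x in completion P. x \<in> E \<longleftrightarrow> x \<in> E'"
    using AE by (rule AE_completion)
  have "E \<inter> space P \<in> sets (completion P)"
  proof (rule completion.in_sets_AE)
    show "AE x in completion P. x \<in> E' \<longleftrightarrow> x \<in> E \<inter> space P"
      using AEC AE_space by eventually_elim auto
  qed (use E' in auto)
  then have m: "indicat_real E \<in> borel_measurable (completion P)"
    by (subst borel_measurable_indicator_iff) (simp add: Int_commute)
  have AEi: "AE x in completion P. indicat_real E x = indicat_real E' x"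
    using AEC by eventually_elim (auto simp: indicator_def)
  have i: "integrable (completion P) (indicat_real E')"
    using E' by (subst integrable_completion) (auto simp: P.emeasure_eq_measure)
  show "integrable (completion P) (indicat_real E)"
    using integrable_cong_AE[OF m borel_measurable_integrable[OF i] AEi] i by blast
  have "(LINT x|completion P. indicat_real E x) = (LINT x|completion P. indicat_real E' x)"
    using m borel_measurable_integrable[OF i] AEi by (rule integral_cong_AE)
  also have "\<dots> = measure P E'"
    using E' sets.sets_into_space[OF E'] by (simp add: integral_completion Int_absorb2)
  finally show "(LINT x|completion P. indicat_real E x) = measure P E'" .
qed

section \<open>Level functions and their one-sided limits\<close>

locale levels =
  fixes M :: "'m set" and A :: "'m \<Rightarrow> real \<Rightarrow> real"
  assumes finite_M: "finite M" and A1: "cond_A1 M A" and A2: "cond_A2 M A"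
begin

lemma A_0: "m \<in> M \<Longrightarrow> A m 0 = 0" and A_1: "m \<in> M \<Longrightarrow> A m 1 = 1"
  and continuous_on_A: "m \<in> M \<Longrightarrow> continuous_on {0..1} (A m)"
  and A_less: "m \<in> M \<Longrightarrow> 0 \<le> s \<Longrightarrow> s < t \<Longrightarrow> t \<le> 1 \<Longrightarrow> A m s < A m t"
  using A1 A2 by (auto simp: cond_A1_def cond_A2_def strict_mono_on_def)

lemma A_le: "m \<in> M \<Longrightarrow> 0 \<le> s \<Longrightarrow> s \<le> t \<Longrightarrow> t \<le> 1 \<Longrightarrow> A m s \<le> A m t"
  using A_less[of m s t] by (cases "s = t") auto

lemma A_bounds: "m \<in> M \<Longrightarrow> 0 \<le> t \<Longrightarrow> t \<le> 1 \<Longrightarrow> 0 \<le> A m t \<and> A m t \<le> 1"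
  using A_le[of m 0 t] A_le[of m t 1] by (simp add: A_0 A_1)

text \<open>Continuity gives the limit and strict monotonicity keeps \<open>A m u\<close> strictly
  to the right of \<open>A m t\<close>. One-sided facts about a path at \<open>A m t\<close> can
  therefore be pulled back to the level \<open>t\<close>.\<close>

lemma filterlim_A_at_right:
  assumes m: "m \<in> M" and t: "0 \<le> t" "t < 1"
  shows "filterlim (A m) (at_right (A m t)) (at_right t)"
proof -
  have "continuous_on {t..1} (A m)"
    using continuous_on_A[OF m] by (rule continuous_on_subset) (use t in auto)
  then have "(A m \<longlongrightarrow> A m t) (at_right t)"
    using t by (auto simp: continuous_on_def at_within_Icc_at_right dest: bspec[of _ _ t])
  moreover have "\<forall>\<^sub>F u in at_right t. A m u > A m t"
    using eventually_at_right_real[OF t(2)] by eventually_elim (use A_less m t in auto)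
  ultimately show ?thesis by (auto simp: filterlim_at elim: eventually_mono)
qed

lemma filterlim_A_at_left:
  assumes m: "m \<in> M" and t: "0 < t" "t \<le> 1"
  shows "filterlim (A m) (at_left (A m t)) (at_left t)"
proof -
  have "continuous_on {0..t} (A m)"
    using continuous_on_A[OF m] by (rule continuous_on_subset) (use t in auto)
  then have "(A m \<longlongrightarrow> A m t) (at_left t)"
    using t by (auto simp: continuous_on_def at_within_Icc_at_left dest: bspec[of _ _ t])
  moreover have "\<forall>\<^sub>F u in at_left t. A m u < A m t"
    using eventually_at_left_real[OF t(1)] by eventually_elim (use A_less m t in auto)
  ultimately show ?thesis by (auto simp: filterlim_at elim: eventually_mono)
qed

section \<open>The stopping level for a fixed family of paths\<close>

definition left_stop_product :: "('m \<Rightarrow> real \<Rightarrow> nat) \<Rightarrow> real \<Rightarrow> real" where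
  "left_stop_product d \<alpha> = (\<Prod>m\<in>M. (1 - A m \<alpha>) ^ (1 - left_lim (d m) (A m \<alpha>)))"

text \<open>Plain values replace the left limits: at a fixed level this depends on finitely many
  decision functions only, which makes it measurable in the sample point.\<close>

definition stop_product :: "('m \<Rightarrow> real \<Rightarrow> nat) \<Rightarrow> real \<Rightarrow> real" where
  "stop_product d \<alpha> = (\<Prod>m\<in>M. (1 - A m \<alpha>) ^ (1 - d m (A m \<alpha>)))"

definition stopping_level :: "('m \<Rightarrow> real \<Rightarrow> nat) \<Rightarrow> real \<Rightarrow> real" where
  "stopping_level d q = unit_Inf {\<alpha>\<in>{0..1}. left_stop_product d \<alpha> < 1 - q}"

lemma alpha_dagger_eq: "alpha_dagger M \<delta> A q x = stopping_level (\<lambda>m t. \<delta> m t x) q"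
  by (simp add: alpha_dagger_def stopping_level_def left_stop_product_def)

lemma stopping_level_bounds: "0 \<le> stopping_level d q" "stopping_level d q \<le> 1"
proof -
  let ?S = "{\<alpha>\<in>{0..1}. left_stop_product d \<alpha> < 1 - q}"
  show "0 \<le> stopping_level d q"
    unfolding stopping_level_def unit_Inf_def by (auto intro!: cInf_greatest)
  show "stopping_level d q \<le> 1"
  proof (cases "?S = {}")
    case False
    then obtain a where a: "a \<in> ?S" by blast
    then have "Inf ?S \<le> a" by (intro cInf_lower bdd_belowI[of _ 0]) auto
    with a show ?thesis by (auto simp: stopping_level_def unit_Inf_def)
  next
    case True
    then show ?thesis unfolding stopping_level_def unit_Inf_def by (simp only: if_True) simp
  qed
qed

lemma left_stop_product_0: "left_stop_product d 0 = 1"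
  by (simp add: left_stop_product_def A_0)

text \<open>Left limits of nondecreasing paths do not exceed the values, so the left exponents are
  the larger ones, and powers of a base in [0, 1] decrease in the exponent.\<close>

lemma left_stop_product_le:
  assumes d: "\<And>m. m \<in> M \<Longrightarrow> decision_path (d m)" and s: "0 \<le> s" "s \<le> 1"
  shows "left_stop_product d s \<le> stop_product d s"
\<comment> \<open>At 0 the left limit would look at levels outside [0, 1], where paths are
  unconstrained; but there every base is 1.\<close>
proof (cases "s = 0")
  case True
  then show ?thesis by (simp add: left_stop_product_def stop_product_def A_0)
next
  case False
  have "left_lim (d m) (A m s) \<le> d m (A m s)" if m: "m \<in> M" for m
    using A_less[OF m, of 0 s] A_bounds[OF m s] False s m
    by (intro left_lim_le d) (auto simp: A_0)
  then show ?thesis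
    unfolding left_stop_product_def stop_product_def
    by (intro prod_mono conjI power_decreasing zero_le_power) (use A_bounds s in fastforce)+
qed

text \<open>The levels can be taken rational because at level \<open>\<alpha>\<close> the left-limit product is the limit
  of the plain product from the left; this is what makes the stopping level measurable.\<close>

lemma stopping_level_less_iff:
  assumes d: "\<And>m. m \<in> M \<Longrightarrow> decision_path (d m)" and q: "0 \<le> q" and r: "r \<le> 1"
  shows "stopping_level d q < r \<longleftrightarrow> (\<exists>s\<in>\<rat> \<inter> {0..<r}. stop_product d s < 1 - q)"
proof -
  let ?S = "{\<alpha>\<in>{0..1}. left_stop_product d \<alpha> < 1 - q}"
  have "stopping_level d q < r \<longleftrightarrow> (\<exists>a\<in>?S. a < r)"
  proof (cases "?S = {}")
    case True
    \<comment> \<open>The default value 1 of the empty infimum is not below \<open>r\<close>,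
      because \<open>r\<close> \<le> 1.\<close>
    then show ?thesis using r by (simp only: stopping_level_def unit_Inf_def if_True) auto
  next
    case False
    have "Inf ?S < r \<longleftrightarrow> (\<exists>a\<in>?S. a < r)"
      by (rule cInf_less_iff[OF False]) (rule bdd_belowI[of _ 0], auto)
    with False show ?thesis by (simp only: stopping_level_def unit_Inf_def if_False)
  qed
  also have "\<dots> \<longleftrightarrow> (\<exists>s\<in>\<rat> \<inter> {0..<r}. stop_product d s < 1 - q)"
  proof
    assume "\<exists>a\<in>?S. a < r"
    then obtain a where a: "0 \<le> a" "a \<le> 1" "a < r" "left_stop_product d a < 1 - q" by auto
    then have a0: "0 < a" using left_stop_product_0[of d] q by (cases "a = 0") auto
    \<comment> \<open>Freezing the exponents at their left limits leaves a continuous function of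
      the level. Just to the left of \<open>a\<close> it coincides with \<open>stop_product\<close>,
      since the paths are constant there.\<close>
    let ?e = "\<lambda>m. 1 - left_lim (d m) (A m a)"
    have ev: "\<forall>\<^sub>F u in at_left a. d m (A m u) = left_lim (d m) (A m a)" if m: "m \<in> M" for m
      using A_less[OF m, of 0 a] A_bounds[OF m, of a] a a0 m
      by (intro eventually_compose_filterlim[OF eventually_at_left_eq_left_lim
            filterlim_A_at_left] d) (auto simp: A_0)
    have lim: "((\<lambda>u. \<Prod>m\<in>M. (1 - A m u) ^ ?e m) \<longlongrightarrow> left_stop_product d a) (at_left a)"
      unfolding left_stop_product_def
      by (intro tendsto_intros) (use filterlim_A_at_left a0 a in \<open>auto simp: filterlim_at\<close>)
    have "\<forall>\<^sub>F u in at_left a. \<forall>m\<in>M. d m (A m u) = left_lim (d m) (A m a)"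
      using ev by (intro eventually_ball_finite finite_M) blast
    then have "\<forall>\<^sub>F u in at_left a. stop_product d u < 1 - q"
      using order_tendstoD(2)[OF lim a(4)]
      by eventually_elim (simp add: stop_product_def)
    then obtain b where b: "b < a" "\<And>u. b < u \<Longrightarrow> u < a \<Longrightarrow> stop_product d u < 1 - q"
      by (auto simp: eventually_at_left_field)
    obtain s where "s \<in> \<rat>" "max 0 b < s" "s < a"
      using Rats_dense_in_real[of "max 0 b" a] a0 b by auto
    then show "\<exists>s\<in>\<rat> \<inter> {0..<r}. stop_product d s < 1 - q"
      using a b by (intro bexI[of _ s]) auto
  next
    assume "\<exists>s\<in>\<rat> \<inter> {0..<r}. stop_product d s < 1 - q"
    then obtain s where "0 \<le> s" "s < r" "stop_product d s < 1 - q" by auto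
    then show "\<exists>a\<in>?S. a < r"
      using left_stop_product_le[of d s, OF d] r by (intro bexI[of _ s]) auto
  qed
  finally show ?thesis .
qed

text \<open>At level 1 every path has value 1, so acceptance at \<open>a\<close> forces
  \<open>a\<close> < 1 and leaves room on the right. Right-continuity of the path then extends the
  acceptance a little beyond \<open>a\<close>.\<close>

lemma eventually_accept_at_right:
  assumes m: "m \<in> M" and d: "decision_path (d m)" and a: "0 \<le> a" "a \<le> 1" "d m (A m a) = 0"
  shows "a < 1" and "\<forall>\<^sub>F u in at_right a. d m (A m u) = 0"
proof -
  show "a < 1" using a decision_pathD(2)[OF d] A_1[OF m] by (cases "a = 1") auto
  then have "A m a < 1" using A_less[OF m, of a 1] a A_1[OF m] by simp
  then show "\<forall>\<^sub>F u in at_right a. d m (A m u) = 0"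
    using eventually_compose_filterlim[OF decision_pathD(5)[OF d, of "A m a"]
        filterlim_A_at_right[OF m, of a]] a \<open>a < 1\<close> A_bounds[OF m, of a] by simp
qed

text \<open>Turns acceptance at the random stopping level into a countable combination of conditions
  at fixed rational levels, hence a measurable one. An accepted hypothesis stays accepted slightly
  beyond the stopping level, so a rational \<open>r\<close> fits in; conversely, monotonicity brings
  acceptance at \<open>r\<close> back down.\<close>

lemma accept_at_stopping_level_iff:
  assumes d: "\<And>m. m \<in> M \<Longrightarrow> decision_path (d m)" and q: "0 \<le> q" and m: "m \<in> M"
  shows "d m (A m (stopping_level d q)) = 0 \<longleftrightarrow>
    (\<exists>r\<in>\<rat> \<inter> {0..1}. d m (A m r) = 0 \<and> (\<exists>s\<in>\<rat> \<inter> {0..<r}. stop_product d s < 1 - q))"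
proof -
  let ?a = "stopping_level d q"
  note a = stopping_level_bounds[of d q]
  have "d m (A m ?a) = 0 \<longleftrightarrow> (\<exists>r\<in>\<rat> \<inter> {0..1}. d m (A m r) = 0 \<and> ?a < r)"
  proof
    assume z: "d m (A m ?a) = 0"
    note R = eventually_accept_at_right[of m d ?a, OF m d[OF m] a z]
    then obtain b where b: "?a < b" "\<And>u. ?a < u \<Longrightarrow> u < b \<Longrightarrow> d m (A m u) = 0"
      by (auto simp: eventually_at_right_field)
    obtain r where "r \<in> \<rat>" "?a < r" "r < min b 1"
      using Rats_dense_in_real[of ?a "min b 1"] b R(1) by auto
    then show "\<exists>r\<in>\<rat> \<inter> {0..1}. d m (A m r) = 0 \<and> ?a < r"
      using a b by (intro bexI[of _ r]) auto
  next
    assume "\<exists>r\<in>\<rat> \<inter> {0..1}. d m (A m r) = 0 \<and> ?a < r"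
    then obtain r where "r \<le> 1" "d m (A m r) = 0" "?a < r" by auto
    then show "d m (A m ?a) = 0"
      using decision_pathD(4)[OF d[OF m], of "A m ?a" "A m r"] A_le[OF m, of ?a r]
        A_bounds[OF m, of ?a] A_bounds[OF m, of r] a by auto
  qed
  then show ?thesis using stopping_level_less_iff[OF d q] by auto
qed

text \<open>The deterministic core, applied with \<open>H\<close> the set of true nulls. Some
  \<open>u\<close> > \<open>w\<close> still has every member of \<open>H\<close> accepted and
  already satisfies the stopping criterion, so stopping occurs no later than \<open>u\<close> and
  monotonicity gives acceptance there.\<close>

lemma accept_at_stopping_level:
  assumes d: "\<And>m. m \<in> M \<Longrightarrow> decision_path (d m)"
    and H: "H \<subseteq> M" and w: "0 \<le> w" "w \<le> 1" "(\<Prod>m\<in>H. 1 - A m w) = 1 - q"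
    and acc: "\<And>m. m \<in> H \<Longrightarrow> d m (A m w) = 0" and m: "m \<in> H"
  shows "d m (A m (stopping_level d q)) = 0"
proof -
  have fin: "finite H" using H finite_M by (rule finite_subset)
  have mM: "m \<in> M" using m H by blast
  have w1: "w < 1" using eventually_accept_at_right(1)[of m d w] d[OF mM] mM acc[OF m] w by auto
  have "\<forall>\<^sub>F u in at_right w. (\<forall>k\<in>H. d k (A k u) = 0) \<and> u \<in> {w<..<1}"
    using fin eventually_accept_at_right(2) d acc w H eventually_at_right_real[OF w1]
    by (intro eventually_conj eventually_ball_finite) auto
  then obtain u where u: "\<And>k. k \<in> H \<Longrightarrow> d k (A k u) = 0" "w < u" "u < 1"
    using eventually_happens'[OF trivial_limit_at_right_real] by fastforce
  have f01: "0 \<le> 1 - A k u" "1 - A k u \<le> 1" if "k \<in> M" for k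
    using A_bounds[OF that, of u] u w by auto
  have "left_stop_product d u \<le> stop_product d u"
    using u w by (intro left_stop_product_le d) auto
  also have "\<dots> = (\<Prod>k\<in>H. 1 - A k u) * (\<Prod>k\<in>M - H. (1 - A k u) ^ (1 - d k (A k u)))"
    unfolding stop_product_def by (subst prod.subset_diff[OF H finite_M]) (simp add: u(1) mult.commute)
  also have "\<dots> \<le> (\<Prod>k\<in>H. 1 - A k u) * 1"
    using f01 H by (intro mult_left_mono prod_le_1 prod_nonneg) (auto intro: power_le_one)
  also have "\<dots> < (\<Prod>k\<in>H. 1 - A k w)"
  \<comment> \<open>\<open>A k w < 1\<close> keeps the factors at \<open>w\<close> positive, so the
    strict decrease of the factor for \<open>m\<close> survives in the product.\<close>
  proof -
    have "A k w < A k u" "A k w < 1" if "k \<in> H" for k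
      using A_less[of k w u] A_less[of k w 1] A_1[of k] that H w u w1 by auto
    then show ?thesis
      using prod_mono_strict[OF m, of "\<lambda>k. 1 - A k u" "\<lambda>k. 1 - A k w"] fin f01 H m
      by (simp add: less_imp_le subset_iff)
  qed
  finally have "left_stop_product d u < 1 - q" using w by simp
  then have "u \<in> {\<alpha>\<in>{0..1}. left_stop_product d \<alpha> < 1 - q}" using u w by simp
  then have "stopping_level d q \<le> u"
    unfolding stopping_level_def unit_Inf_def
    by (auto intro!: cInf_lower bdd_belowI[of _ 0])
  then have "A m (stopping_level d q) \<le> A m u"
    using stopping_level_bounds[of d q] u mM by (intro A_le) auto
  then show ?thesis
    using decision_pathD(4)[OF d[OF mM], of "A m (stopping_level d q)" "A m u"] u(1)[OF m]
      A_bounds[OF mM, of "stopping_level d q"] stopping_level_bounds[of d q]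
      A_bounds[OF mM, of u] u w by auto
qed

text \<open>The product falls continuously from 1 at level 0 to 0 at level 1. Reaching 0 requires a
  factor, hence the nonempty \<open>H\<close>.\<close>

lemma obtain_level:
  assumes H: "H \<subseteq> M" "H \<noteq> {}" and q: "0 \<le> q" "q \<le> 1"
  obtains w where "0 \<le> w" "w \<le> 1" "(\<Prod>m\<in>H. 1 - A m w) = 1 - q"
proof -
  have fin: "finite H" using H finite_M by (auto intro: finite_subset)
  have "\<exists>w\<ge>0. w \<le> 1 \<and> (\<Prod>m\<in>H. 1 - A m w) = 1 - q"
  proof (rule IVT2')
    show "continuous_on {0..1} (\<lambda>w. \<Prod>m\<in>H. 1 - A m w)"
      using H continuous_on_A by (intro continuous_intros) auto
    have "(\<Prod>m\<in>H. 1 - A m 1) = 0"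
      using H fin A_1 by (intro prod_zero) (auto simp: subset_iff)
    then show "(\<Prod>m\<in>H. 1 - A m 1) \<le> 1 - q" using q by simp
    have "(\<Prod>m\<in>H. 1 - A m 0) = 1"
      using H A_0 by (intro prod.neutral) auto
    then show "1 - q \<le> (\<Prod>m\<in>H. 1 - A m 0)" using q by simp
  qed simp
  then show ?thesis using that by blast
qed

end

section \<open>Probability of a null rejection at fixed levels\<close>

lemma (in prob_space) prob_some_rejection:
  assumes indep: "indep_vars (\<lambda>_. path_space) (\<lambda>m x. sample_path \<delta> m x) H"
    and H: "finite H" "H \<noteq> {}"
    and meas: "\<And>m. m \<in> H \<Longrightarrow> \<delta> m (t m) \<in> measurable M (count_space {0, 1})"
    and t: "\<And>m. m \<in> H \<Longrightarrow> t m \<in> {0..1}"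
    and unif: "\<And>m. m \<in> H \<Longrightarrow> (LINT x|M. real (\<delta> m (t m) x)) = t m"
  shows "prob {x\<in>space M. \<exists>m\<in>H. \<delta> m (t m) x \<noteq> 0} = 1 - (\<Prod>m\<in>H. 1 - t m)"
proof -
  have set: "{x\<in>space M. \<delta> m (t m) x \<noteq> 0} \<in> events" if "m \<in> H" for m
  proof -
    have "{x\<in>space M. \<delta> m (t m) x \<noteq> 0} = \<delta> m (t m) -` {1} \<inter> space M"
      using measurable_space[OF meas[OF that]] by fastforce
    then show ?thesis using measurable_sets[OF meas[OF that], of "{1}"] by simp
  qed
  have single: "prob {x\<in>space M. \<delta> m (t m) x = 0} = 1 - t m" if m: "m \<in> H" for m
  proof -
    \<comment> \<open>A {0, 1}-valued decision is the indicator of its rejection event, so its mean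
      is the rejection probability.\<close>
    have "(LINT x|M. real (\<delta> m (t m) x)) =
        (LINT x|M. indicat_real {x\<in>space M. \<delta> m (t m) x \<noteq> 0} x)"
    proof (intro Bochner_Integration.integral_cong refl)
      fix x assume x: "x \<in> space M"
      show "real (\<delta> m (t m) x) = indicat_real {x\<in>space M. \<delta> m (t m) x \<noteq> 0} x"
        using measurable_space[OF meas[OF m] x] x by (auto simp: indicator_def)
    qed
    also have "\<dots> = prob {x\<in>space M. \<delta> m (t m) x \<noteq> 0}"
      by (simp add: Int_absorb2)
    finally show ?thesis using prob_neg[OF set[OF m]] unif[OF m] by simp
  qed
  \<comment> \<open>Evaluation of a path at the coordinate \<open>t m\<close> is measurable for the
    product sigma-algebra, so independence of the paths passes to the decisions at fixed levels, and
    the probability of no rejection factorizes.\<close>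
  have ind: "indep_vars (\<lambda>_. count_space {0, 1}) (\<lambda>m x. sample_path \<delta> m x (t m)) H"
    using t by (intro indep_vars_compose2[OF indep] measurable_component_singleton) auto
  have "prob (\<Inter>m\<in>H. (\<lambda>x. sample_path \<delta> m x (t m)) -` {0} \<inter> space M) =
      (\<Prod>m\<in>H. prob ((\<lambda>x. sample_path \<delta> m x (t m)) -` {0} \<inter> space M))"
    using H by (intro indep_varsD_finite[OF ind]) auto
  also have "\<dots> = (\<Prod>m\<in>H. 1 - t m)"
  proof (rule prod.cong)
    fix m assume m: "m \<in> H"
    then have "(\<lambda>x. sample_path \<delta> m x (t m)) -` {0} \<inter> space M = {x\<in>space M. \<delta> m (t m) x = 0}"
      using t by (auto simp: sample_path_def)
    then show "prob ((\<lambda>x. sample_path \<delta> m x (t m)) -` {0} \<inter> space M) = 1 - t m"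
      using single[OF m] by simp
  qed simp
  also have "(\<Inter>m\<in>H. (\<lambda>x. sample_path \<delta> m x (t m)) -` {0} \<inter> space M) =
      {x\<in>space M. \<not> (\<exists>m\<in>H. \<delta> m (t m) x \<noteq> 0)}"
    using t H by (auto simp: sample_path_def)
  finally show ?thesis
    using set H(1) by (subst (asm) prob_neg) (auto intro: sets.sets_Collect_finite_Ex)
qed

section \<open>Error rate of the stopped procedure\<close>

theorem theorem3p1:
  fixes F :: "'x measure"
    and \<P> :: "'x measure set"
    and M :: "'m set"
    and M0 M1 :: "'x measure \<Rightarrow> 'm set"
    and \<delta> :: "'m \<Rightarrow> real \<Rightarrow> 'x \<Rightarrow> nat"
    and A :: "'m \<Rightarrow> real \<Rightarrow> real"
  assumes "statistical_model F \<P>"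
    and "finite M"
    and "\<And>P. P \<in> \<P> \<Longrightarrow> M0 P \<inter> M1 P = {} \<and> M0 P \<union> M1 P = M"
    and "decision_process F M \<delta>"
    and "cond_D1 \<P> M \<delta>"
    and "cond_D2 \<P> M \<delta>"
    and "cond_D3 \<P> M0 M1 \<delta>"
    and "cond_D4 \<P> M0 \<delta>"
    and "measurable_unit_maps M A"
    and "cond_A1 M A"
    and "cond_A2 M A"
    and "cond_A3 M A"
    and "AE_all \<P> (\<lambda>x. inj_on (\<lambda>m. gen_p_value \<delta> A m x) M)"
  shows "\<forall>P\<in>\<P>. \<forall>q\<in>{0..1}.
    integrable (completion P)
      (indicat_real {x. S0 M0 \<delta> A P (alpha_dagger M \<delta> A q x) x \<ge> 1}) \<and>
    (LINT x|completion P.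
      indicat_real {x. S0 M0 \<delta> A P (alpha_dagger M \<delta> A q x) x \<ge> 1} x) \<le> q \<and>
    family_wise_error_rate P (M0 P) (\<lambda>m x. \<delta> m (A m (alpha_dagger M \<delta> A q x)) x) \<le> q"
proof -
  interpret levels M A using assms by unfold_locales
  have main: "integrable (completion P)
      (indicat_real {x. S0 M0 \<delta> A P (alpha_dagger M \<delta> A q x) x \<ge> 1}) \<and>
    (LINT x|completion P.
      indicat_real {x. S0 M0 \<delta> A P (alpha_dagger M \<delta> A q x) x \<ge> 1} x) \<le> q"
    if P: "P \<in> \<P>" and "q \<in> {0..1}" for P q
  proof -
    have q: "0 \<le> q" "q \<le> 1" using that by auto
    interpret P: prob_space P using assms(1) P by (simp add: statistical_model_def)
    have H: "M0 P \<subseteq> M" using assms(3)[OF P] by blast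
    have fin: "finite (M0 P)" using H finite_M by (rule finite_subset)
    have meas: "\<delta> m t \<in> measurable P (count_space {0, 1})" if "m \<in> M" "0 \<le> t" "t \<le> 1" for m t
    proof -
      have "sets P = sets F" using assms(1) P by (simp add: statistical_model_def)
      then show ?thesis
        using assms(4) that by (subst measurable_cong_sets[OF _ refl]) (auto simp: decision_process_def)
    qed
    have [measurable]: "\<delta> m (A m s) \<in> measurable P (count_space UNIV)"
      if "m \<in> M" "0 \<le> s" "s \<le> 1" for m s
      using measurable_compose[OF meas[OF that(1), of "A m s"], of "\<lambda>k. k" "count_space UNIV"]
        A_bounds[OF that] by (simp add: measurable_count_space_eq1)
    let ?d = "\<lambda>x m t. \<delta> m t x"
    have path: "AE x in P. \<forall>m\<in>M. decision_path (\<lambda>t. \<delta> m t x)"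
    proof (rule AE_finite_allI[OF finite_M])
      fix m assume m: "m \<in> M"
      have "AE x in P. \<delta> m 0 x = 0 \<and> \<delta> m 1 x = 1"
        using assms(5) m P by (auto simp: cond_D1_def AE_all_def)
      moreover have "AE x in P. (\<forall>t\<in>{0..1}. \<delta> m t x \<in> {0, 1}) \<and> mono_on {0..1} (\<lambda>t. \<delta> m t x) \<and>
          (\<forall>t\<in>{0..<1}. continuous (at_right t) (\<lambda>t. \<delta> m t x))"
        using assms(6)[unfolded cond_D2_def AE_all_def, rule_format, OF m P]
        by (rule eventually_mono) blast
      ultimately show "AE x in P. decision_path (\<lambda>t. \<delta> m t x)"
        by eventually_elim (simp add: decision_path_def)
    qed
    define E where "E = {x. S0 M0 \<delta> A P (alpha_dagger M \<delta> A q x) x \<ge> 1}"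
    have E_iff: "x \<in> E \<longleftrightarrow> (\<exists>m\<in>M0 P. ?d x m (A m (stopping_level (?d x) q)) \<noteq> 0)" for x
    proof -
      have "x \<in> E \<longleftrightarrow> S0 M0 \<delta> A P (alpha_dagger M \<delta> A q x) x \<noteq> 0"
        by (simp add: E_def Suc_le_eq)
      then show ?thesis using fin by (simp add: S0_def alpha_dagger_eq)
    qed
    \<comment> \<open>\<open>E'\<close> is the error event \<open>E\<close> rewritten through
      rational levels by \<open>accept_at_stopping_level_iff\<close>; the two agree wherever all
      paths are regular.\<close>
    define E' where "E' = {x\<in>space P. \<exists>m\<in>M0 P. \<not> (\<exists>r\<in>\<rat> \<inter> {0..1}.
      \<delta> m (A m r) x = 0 \<and> (\<exists>s\<in>\<rat> \<inter> {0..<r}. stop_product (?d x) s < 1 - q))}"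
    have E': "E' \<in> sets P"
    proof -
      have ctb: "countable (\<rat> \<inter> S :: real set)" for S
        by (rule countable_subset[OF _ countable_rat]) auto
      have [measurable]: "(\<lambda>x. stop_product (?d x) s) \<in> borel_measurable P" if "0 \<le> s" "s \<le> 1" for s
        unfolding stop_product_def
      proof (rule borel_measurable_prod)
        fix m assume "m \<in> M"
        then have [measurable]: "\<delta> m (A m s) \<in> measurable P (count_space UNIV)"
          using that by measurable
        show "(\<lambda>x. (1 - A m s) ^ (1 - \<delta> m (A m s) x)) \<in> borel_measurable P" by measurable
      qed
      show ?thesis
        unfolding E'_def using H
        by (intro sets.sets_Collect_finite_Ex fin sets.sets_Collect_neg
            sets.sets_Collect_countable_Ex' ctb sets.sets_Collect_conj) auto
    qed
    have EE': "AE x in P. x \<in> E \<longleftrightarrow> x \<in> E'"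
      using path AE_space
    proof eventually_elim
      case (elim x)
      have "?d x m (A m (stopping_level (?d x) q)) = 0 \<longleftrightarrow> (\<exists>r\<in>\<rat> \<inter> {0..1}.
          \<delta> m (A m r) x = 0 \<and> (\<exists>s\<in>\<rat> \<inter> {0..<r}. stop_product (?d x) s < 1 - q))"
        if "m \<in> M0 P" for m
        using elim(1) that H by (intro accept_at_stopping_level_iff q) auto
      then show ?case
        unfolding E_iff E'_def using elim(2) by (simp cong: bex_cong)
    qed
    have "measure P E' \<le> q"
    proof (cases "M0 P = {}")
      case True
      then show ?thesis using q by (simp add: E'_def)
    next
      case False
      obtain w where w: "0 \<le> w" "w \<le> 1" "(\<Prod>m\<in>M0 P. 1 - A m w) = 1 - q"
        using obtain_level[OF H False q] .
      let ?B = "{x\<in>space P. \<exists>m\<in>M0 P. \<delta> m (A m w) x \<noteq> 0}"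
      have B: "?B \<in> sets P"
        using w H by (intro sets.sets_Collect_finite_Ex fin) auto
      \<comment> \<open>On regular paths, acceptance of all true nulls at \<open>w\<close> persists
        at the stopping level, so an error there requires some true null to be rejected already at
        the deterministic level \<open>w\<close>.\<close>
      have "AE x in P. x \<in> E' \<longrightarrow> x \<in> ?B"
        using path EE' AE_space
      proof eventually_elim
        case (elim x)
        have "\<exists>m\<in>M0 P. \<delta> m (A m w) x \<noteq> 0" if "x \<in> E"
        proof (rule ccontr)
          assume "\<not> (\<exists>m\<in>M0 P. \<delta> m (A m w) x \<noteq> 0)"
          then have acc: "\<forall>m\<in>M0 P. \<delta> m (A m w) x = 0" by simp
          have "?d x m (A m (stopping_level (?d x) q)) = 0" if "m \<in> M0 P" for m
            by (rule accept_at_stopping_level[OF _ H w _ that]) (use elim(1) acc in auto)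
          then show False using \<open>x \<in> E\<close> by (simp add: E_iff)
        qed
        then show ?case using elim(2,3) by simp
      qed
      then have "measure P E' \<le> measure P ?B"
        using B by (rule P.finite_measure_mono_AE)
      also have "\<dots> = 1 - (\<Prod>m\<in>M0 P. 1 - A m w)"
      proof (rule P.prob_some_rejection[OF _ fin False])
        show "P.indep_vars (\<lambda>_. path_space) (\<lambda>m x. sample_path \<delta> m x) (M0 P)"
          using assms(7) P by (simp add: cond_D3_def)
        show "\<delta> m (A m w) \<in> measurable P (count_space {0, 1})" if "m \<in> M0 P" for m
          using meas A_bounds[of m w] w H that by auto
        show "A m w \<in> {0..1}" if "m \<in> M0 P" for m
          using A_bounds[of m w] w H that by auto
        then show "(LINT x|P. real (\<delta> m (A m w) x)) = A m w" if "m \<in> M0 P" for m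
          using assms(8) P that by (simp add: cond_D4_def)
      qed
      finally show ?thesis using w by simp
    qed
    then show ?thesis
      using integral_completion_indicator_AE_eq[OF P.finite_measure_axioms E' EE']
      unfolding E_def by simp
  qed
  then show ?thesis
    by (auto simp: family_wise_error_rate_def S0_def)
qed

end
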